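(* Let $m\geq 4$ be an even integer and let $d$ be an integer with $\frac{m}{2}+3\leq d\leq \frac{3m}{2}$. Then $$\tau_{d}(P_m\square C_3)=4d-\frac{m}{2}-2+\left\lfloor \frac{2d-m-2}{4}\right\rfloor.$$
   Context: All graphs are simple, finite and undirected. A matching of a graph $G$ is a set of edges no two of which share an endpoint; a maximum matching is a matching of largest cardinality, and this cardinality is denoted $\nu(G)$. For an integer $d$ with $1\leq d\leq \nu(G)$, a $d$-transversal set of $G$ is a set $T\subseteq E(G)$ such that $|T\cap M|\geq d$ for every maximum matching $M$ of $G$; $\tau_d(G)$ denotes the minimum cardinality of a $d$-transversal set of $G$. $P_m$ is the path with $m$ vertices, $C_3$ is the cycle with $3$ vertices. The Cartesian product $G\square H$ has vertex set $V(G)\times V(H)$, with $(g_1,h_1)$ and $(g_2,h_2)$ adjacent iff either $g_1=g_2$ and $h_1h_2\in E(H)$, or $g_1g_2\in E(G)$ and $h_1=h_2$. $\lfloor x\rfloor$ is the greatest integer not greater than $x$. *)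

theory Defs
  imports Complex_Main
begin

record 'a sgraph =
  verts :: "'a set"
  edges :: "'a set set"

definition finite_simple_graph :: "'a sgraph \<Rightarrow> bool" where
  "finite_simple_graph G \<longleftrightarrow>
     finite (verts G) \<and> (\<forall>e\<in>edges G. e \<subseteq> verts G \<and> card e = 2)"

definition path_graph :: "nat \<Rightarrow> nat sgraph" where
  "path_graph m = \<lparr>verts = {..<m}, edges = {{i, Suc i} | i. Suc i < m}\<rparr>"

(* Only meaningful as a simple graph for n at least 3. *)
definition cycle_graph :: "nat \<Rightarrow> nat sgraph" where
  "cycle_graph n = \<lparr>verts = {..<n}, edges = {{i, Suc i mod n} | i. i < n}\<rparr>"

definition cartesian_product :: "'a sgraph \<Rightarrow> 'b sgraph \<Rightarrow> ('a \<times> 'b) sgraph"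
    (infixl \<open>\<box>\<close> 70) where
  "G \<box> H =
     \<lparr>verts = verts G \<times> verts H,
      edges = {{(g1, h1), (g2, h2)} | g1 h1 g2 h2.
                 (g1, h1) \<in> verts G \<times> verts H \<and> (g2, h2) \<in> verts G \<times> verts H \<and>
                 (g1 = g2 \<and> {h1, h2} \<in> edges H \<or> {g1, g2} \<in> edges G \<and> h1 = h2)}\<rparr>"

definition matching :: "'a sgraph \<Rightarrow> 'a set set \<Rightarrow> bool" where
  "matching G M \<longleftrightarrow> M \<subseteq> edges G \<and> (\<forall>e\<in>M. \<forall>f\<in>M. e \<noteq> f \<longrightarrow> e \<inter> f = {})"

definition matching_number :: "'a sgraph \<Rightarrow> nat" ("\<nu>") where
  "\<nu> G = Max {card M | M. matching G M}"

definition maximum_matching :: "'a sgraph \<Rightarrow> 'a set set \<Rightarrow> bool" where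
  "maximum_matching G M \<longleftrightarrow> matching G M \<and> card M = \<nu> G"

(* The notion is intended for d between 1 and the matching number, which is therefore part
   of the definition. *)
definition transversal_set :: "'a sgraph \<Rightarrow> nat \<Rightarrow> 'a set set \<Rightarrow> bool" where
  "transversal_set G d T \<longleftrightarrow>
     1 \<le> d \<and> d \<le> \<nu> G \<and> T \<subseteq> edges G \<and>
     (\<forall>M. maximum_matching G M \<longrightarrow> d \<le> card (T \<inter> M))"

definition transversal_number :: "nat \<Rightarrow> 'a sgraph \<Rightarrow> nat" ("\<tau>") where
  "\<tau> d G = Min {card T | T. transversal_set G d T}"

lemma finite_edges: "finite_simple_graph G \<Longrightarrow> finite (edges G)"
  by (rule finite_subset[of _ "Pow (verts G)"]) (auto simp: finite_simple_graph_def)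

lemma finite_simple_path_graph: "finite_simple_graph (path_graph m)"
  by (auto simp: finite_simple_graph_def path_graph_def)

lemma finite_simple_cycle_graph:
  assumes "n \<ge> 3"
  shows "finite_simple_graph (cycle_graph n)"
proof -
  have "i \<noteq> Suc i mod n" if "i < n" for i
    using that assms by (cases "Suc i = n") auto
  then show ?thesis
    using assms by (auto simp: finite_simple_graph_def cycle_graph_def card_2_iff)
qed

lemma finite_simple_cartesian_product:
  assumes "finite_simple_graph G" and "finite_simple_graph H"
  shows "finite_simple_graph (G \<box> H)"
proof -
  have "x \<noteq> y" if "{x, y} \<in> edges G" for x y
    using assms(1) that by (fastforce simp: finite_simple_graph_def)
  moreover have "x \<noteq> y" if "{x, y} \<in> edges H" for x y
    using assms(2) that by (fastforce simp: finite_simple_graph_def)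
  ultimately have "card e = 2" if "e \<in> edges (G \<box> H)" for e
    using that by (fastforce simp: cartesian_product_def card_insert_if)
  moreover have "e \<subseteq> verts (G \<box> H)" if "e \<in> edges (G \<box> H)" for e
    using that by (auto simp: cartesian_product_def)
  moreover have "finite (verts (G \<box> H))"
    using assms by (simp add: cartesian_product_def finite_simple_graph_def)
  ultimately show ?thesis
    by (simp add: finite_simple_graph_def)
qed

lemma finite_matching_cards:
  assumes "finite_simple_graph G"
  shows "finite {card M | M. matching G M}"
proof -
  have "{card M | M. matching G M} \<subseteq> card ` Pow (edges G)"
    by (auto simp: matching_def)
  then show ?thesis
    using finite_edges[OF assms] by (meson finite_Pow_iff finite_imageI finite_subset)
qed

lemma ex_maximum_matching:
  assumes "finite_simple_graph G"
  shows "\<exists>M. maximum_matching G M"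
proof -
  have "matching G {}"
    by (simp add: matching_def)
  then have "{card M | M. matching G M} \<noteq> {}"
    by blast
  from Max_in[OF finite_matching_cards[OF assms] this] show ?thesis
    by (auto simp: maximum_matching_def matching_number_def)
qed

(* The minimum defining the transversal number ranges over a finite nonempty set and is
   therefore attained. *)
lemma transversal_number_attained:
  assumes "finite_simple_graph G" and "1 \<le> d" and "d \<le> \<nu> G"
  shows "\<exists>T. transversal_set G d T \<and> card T = \<tau> d G"
proof -
  have "{card T | T. transversal_set G d T} \<subseteq> card ` Pow (edges G)"
    by (auto simp: transversal_set_def)
  then have fin: "finite {card T | T. transversal_set G d T}"
    using finite_edges[OF assms(1)] by (meson finite_Pow_iff finite_imageI finite_subset)
  have "transversal_set G d (edges G)"
    using assms
    by (auto simp: transversal_set_def maximum_matching_def matching_def Int_absorb1)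
  then have "{card T | T. transversal_set G d T} \<noteq> {}"
    by blast
  from Min_in[OF fin this] show ?thesis
    by (auto simp: transversal_number_def)
qed

end

theory Submission
  imports Defs
begin

text \<open>
  Write \<open>m = 2 p\<close> and \<open>k = 3 p - d\<close>. The graph has a perfect matching, so the maximum matchings are
  exactly the perfect ones, each with \<open>3 p\<close> edges. Passing to the complement, a set \<open>T\<close> of edges is
  \<open>d\<close>-transversal iff its complement \<open>S\<close> meets every perfect matching in at most \<open>k\<close> edges. Hence
  the transversal number is \<open>6 m - 3\<close>, the number of edges, minus the largest size of such an \<open>S\<close>,
  and the theorem says that this largest size is \<open>\<lfloor>9 k / 2\<rfloor>\<close>.

  Upper bound (\<open>card_le_if_few_in_perfect_matchings\<close>): there are nine perfect matchings, counted with
  multiplicity, that together cover every edge at least twice. Summing \<open>|S \<inter> M| \<le> k\<close> over them gives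
  \<open>2 |S| \<le> 9 k\<close>.

  Construction (\<open>ex_few_in_perfect_matchings\<close>): call the edges inside a copy of the triangle sides
  and the edges between consecutive copies rungs; the copies are the columns, numbered from \<open>0\<close>, and
  a rung leaves the column with the smaller number. A block consists of the rungs between the columns
  \<open>i\<close> and \<open>i + 1\<close>, where \<open>i\<close> is odd, and of the sides in these two columns. It has nine edges, and a
  perfect matching contains at most two of them. The reason is parity (\<open>card_block_Int_le_2\<close>): the
  columns up to \<open>i\<close> have an even number of vertices, so the matching contains an even number of the
  rungs between the columns \<open>i\<close> and \<open>i + 1\<close>. If
  this number is \<open>0\<close>, only one side per column remains; if it is \<open>2\<close>, the two columns have no room for
  a side. The set \<open>S\<close> is the union of \<open>\<lfloor>k / 2\<rfloor>\<close> blocks, together with the four edges at one further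
  vertex if \<open>k\<close> is odd. The bound \<open>k \<le> m - 3\<close>, which is the lower bound on \<open>d\<close>, leaves enough
  columns for this.
\<close>

section \<open>Matchings and transversal sets\<close>

definition perfect_matching :: "'a sgraph \<Rightarrow> 'a set set \<Rightarrow> bool" where
  "perfect_matching G M \<longleftrightarrow> matching G M \<and> \<Union>M = verts G"

lemma finite_matching: "finite_simple_graph G \<Longrightarrow> matching G M \<Longrightarrow> finite M"
  unfolding matching_def using finite_edges finite_subset by blast

text \<open>Two choices of \<open>U\<close> matter: the set of all vertices, which gives the size of a perfect matching,
  and an initial segment of columns, which gives a parity constraint on the edges leaving it.\<close>

lemma sum_card_Int_matching:
  assumes "finite_simple_graph G" and M: "matching G M"
  shows "(\<Sum>e\<in>M. card (e \<inter> U)) = card (\<Union>M \<inter> U)"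
proof -
  have "finite e" if "e \<in> M" for e
    using that assms unfolding matching_def finite_simple_graph_def
    by (meson finite_subset subsetD)
  moreover have "(e \<inter> U) \<inter> (f \<inter> U) = {}" if "e \<in> M" "f \<in> M" "e \<noteq> f" for e f
    using that M unfolding matching_def by blast
  ultimately have "card (\<Union>e\<in>M. e \<inter> U) = (\<Sum>e\<in>M. card (e \<inter> U))"
    using finite_matching[OF assms] by (intro card_UN_disjoint) simp_all
  moreover have "(\<Union>e\<in>M. e \<inter> U) = \<Union>M \<inter> U"
    by auto
  ultimately show ?thesis by simp
qed

lemma card_Union_matching:
  assumes G: "finite_simple_graph G" and M: "matching G M"
  shows "card (\<Union>M) = 2 * card M"
proof -
  have "card (\<Union>M) = (\<Sum>e\<in>M. card (e \<inter> UNIV))"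
    using sum_card_Int_matching[OF assms, of UNIV] by (simp only: Int_UNIV_right)
  also have "\<dots> = (\<Sum>e\<in>M. 2)"
    using assms by (intro sum.cong) (auto simp: matching_def finite_simple_graph_def)
  finally show ?thesis by simp
qed

lemma perfect_matchingI:
  assumes G: "finite_simple_graph G" and M: "M \<subseteq> edges G"
    and disj: "\<And>e f. e \<in> M \<Longrightarrow> f \<in> M \<Longrightarrow> e \<noteq> f \<Longrightarrow> e \<inter> f = {}"
    and cover: "\<And>v. v \<in> verts G \<Longrightarrow> v \<in> \<Union>M"
  shows "perfect_matching G M"
proof -
  have "\<Union>M \<subseteq> verts G"
    using G M unfolding finite_simple_graph_def by blast
  then show ?thesis
    using M disj cover unfolding perfect_matching_def matching_def by blast
qed

lemma maximum_matching_iff_perfect: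
  assumes G: "finite_simple_graph G" and P: "perfect_matching G P"
  shows "maximum_matching G M \<longleftrightarrow> perfect_matching G M"
    and "card (verts G) = 2 * \<nu> G"
proof -
  have fin: "finite (verts G)"
    using G by (simp add: finite_simple_graph_def)
  have sub: "\<Union>N \<subseteq> verts G" if "matching G N" for N
    using that G by (auto simp: matching_def finite_simple_graph_def)
  have "2 * card N \<le> card (verts G)" if "matching G N" for N
    using card_mono[OF fin sub[OF that]] card_Union_matching[OF G that] by simp
  moreover have "2 * card P = card (verts G)"
    using card_Union_matching[OF G, of P] P by (simp add: perfect_matching_def)
  ultimately have "\<nu> G = card P"
    unfolding matching_number_def using P
    by (intro Max_eqI finite_matching_cards[OF G]) (force simp: perfect_matching_def)+
  then show card_verts: "card (verts G) = 2 * \<nu> G"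
    using \<open>2 * card P = card (verts G)\<close> by simp
  show "maximum_matching G M \<longleftrightarrow> perfect_matching G M"
    unfolding maximum_matching_def perfect_matching_def
    using card_verts card_Union_matching[OF G, of M] card_subset_eq[OF fin sub, of M] by auto
qed

lemma card_Int_matching_le_1:
  assumes "finite F" and "matching G M"
    and "\<And>e f. e \<in> F \<Longrightarrow> f \<in> F \<Longrightarrow> e \<inter> f \<noteq> {}"
  shows "card (F \<inter> M) \<le> 1"
proof -
  have "e = f" if "e \<in> F \<inter> M" "f \<in> F \<inter> M" for e f
    using assms(2) assms(3)[of e f] that unfolding matching_def by blast
  then show ?thesis
    using \<open>finite F\<close> by (simp add: card_le_Suc0_iff_eq)
qed

text \<open>Maximum matchings all have the same size, so meeting each of them often is the same as missing
  each of them rarely.\<close>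

lemma transversal_set_iff_complement:
  assumes G: "finite_simple_graph G" and "1 \<le> d" and "d \<le> \<nu> G" and T: "T \<subseteq> edges G"
  shows "transversal_set G d T \<longleftrightarrow>
           (\<forall>M. maximum_matching G M \<longrightarrow> card ((edges G - T) \<inter> M) \<le> \<nu> G - d)"
proof -
  have "d \<le> card (T \<inter> M) \<longleftrightarrow> card ((edges G - T) \<inter> M) \<le> \<nu> G - d"
    if "maximum_matching G M" for M
  proof -
    have M: "M \<subseteq> edges G" "finite M" "card M = \<nu> G"
      using that finite_matching[OF G] by (auto simp: maximum_matching_def matching_def)
    moreover have "(edges G - T) \<inter> M = M - T"
      using M by auto
    ultimately have "card M = card (T \<inter> M) + card ((edges G - T) \<inter> M)"
      using card_Int_Diff[of M T] by (simp add: Int_commute)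
    then show ?thesis
      using M assms(3) by linarith
  qed
  then show ?thesis
    using assms by (auto simp: transversal_set_def)
qed

text \<open>The minimisation over transversal sets becomes a maximisation over their complements. The latter
  is more convenient: the condition on \<open>S\<close> is inherited by subsets and adds up over unions.\<close>

lemma transversal_number_complement:
  assumes G: "finite_simple_graph G" and d: "1 \<le> d" "d \<le> \<nu> G"
    and S: "S \<subseteq> edges G" "\<And>M. maximum_matching G M \<Longrightarrow> card (S \<inter> M) \<le> \<nu> G - d"
    and best: "\<And>S'. S' \<subseteq> edges G \<Longrightarrow>
      (\<And>M. maximum_matching G M \<Longrightarrow> card (S' \<inter> M) \<le> \<nu> G - d) \<Longrightarrow> card S' \<le> card S"
  shows "\<tau> d G = card (edges G) - card S"
  unfolding transversal_number_def
proof (rule Min_eqI)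
  note fin = finite_edges[OF G]
  have "{card T | T. transversal_set G d T} \<subseteq> card ` Pow (edges G)"
    by (auto simp: transversal_set_def)
  then show "finite {card T | T. transversal_set G d T}"
    using fin by (meson finite_Pow_iff finite_imageI finite_subset)
  show "card (edges G) - card S \<le> n" if n: "n \<in> {card T | T. transversal_set G d T}" for n
  proof -
    obtain T where T: "n = card T" "transversal_set G d T"
      using n by blast
    then have "T \<subseteq> edges G"
      by (simp add: transversal_set_def)
    then have "card (edges G - T) \<le> card S"
      using T transversal_set_iff_complement[OF G d] by (intro best) auto
    then show ?thesis
      using T \<open>T \<subseteq> edges G\<close> fin by (simp add: card_Diff_subset finite_subset)
  qed
  have "transversal_set G d (edges G - S)"
    using S transversal_set_iff_complement[OF G d, of "edges G - S"]
    by (simp add: double_diff)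
  then show "card (edges G) - card S \<in> {card T | T. transversal_set G d T}"
    using S fin finite_subset by (metis (mono_tags, lifting) card_Diff_subset mem_Collect_eq)
qed

text \<open>This is weak duality for the linear program that maximises \<open>|S|\<close>: the weights \<open>w\<close> form a
  fractional \<open>c\<close>-fold cover by the sets \<open>M i\<close>.\<close>

lemma weighted_double_count:
  fixes w :: "'i \<Rightarrow> nat"
  assumes "finite S" and "finite I"
    and cover: "\<And>e. e \<in> S \<Longrightarrow> c \<le> sum w {i \<in> I. e \<in> M i}"
    and few: "\<And>i. i \<in> I \<Longrightarrow> card (S \<inter> M i) \<le> k"
  shows "c * card S \<le> k * sum w I"
proof -
  have "c * card S = (\<Sum>e\<in>S. c)"
    by simp
  also have "\<dots> \<le> (\<Sum>e\<in>S. \<Sum>i\<in>{i \<in> I. e \<in> M i}. w i)"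
    by (intro sum_mono cover)
  also have "\<dots> = (\<Sum>i\<in>I. \<Sum>e\<in>{e \<in> S. e \<in> M i}. w i)"
    using assms by (intro sum.swap_restrict)
  also have "\<dots> = (\<Sum>i\<in>I. card (S \<inter> M i) * w i)"
    by (simp add: Int_def)
  also have "\<dots> \<le> (\<Sum>i\<in>I. k * w i)"
    by (intro sum_mono mult_right_mono few) auto
  finally show ?thesis
    by (simp add: sum_distrib_left)
qed

section \<open>Edges of the product of a path and a triangle\<close>

abbreviation prism :: "nat \<Rightarrow> (nat \<times> nat) sgraph" where
  "prism m \<equiv> path_graph m \<box> cycle_graph 3"

definition rung :: "nat \<Rightarrow> nat \<Rightarrow> (nat \<times> nat) set" where
  "rung i a = {i, Suc i} \<times> {a}"

text \<open>A side is indexed by the vertex of the triangle that it avoids. Sides and rungs with the same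
  second index are therefore disjoint, which makes the matchings below easy to write down.\<close>

definition side :: "nat \<Rightarrow> nat \<Rightarrow> (nat \<times> nat) set" where
  "side i a = {i} \<times> ({..<3} - {a})"

lemma lessThan_3: "{..<3} = {0, 1, 2::nat}"
  by auto

lemma less_3_iff: "a < (3::nat) \<longleftrightarrow> a = 0 \<or> a = 1 \<or> a = 2"
  by auto

lemma finite_simple_prism: "finite_simple_graph (prism m)"
  by (simp add: finite_simple_cartesian_product finite_simple_path_graph finite_simple_cycle_graph)

lemma verts_prism: "verts (prism m) = {..<m} \<times> {..<3}"
  by (simp add: cartesian_product_def path_graph_def cycle_graph_def)

lemma edges_prism:
  "edges (prism m) = {side i a | i a. i < m \<and> a < 3} \<union> {rung i a | i a. Suc i < m \<and> a < 3}"
  (is "_ = ?sides \<union> ?rungs")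
proof
  have cyc: "{a, b} \<in> edges (cycle_graph 3) \<longleftrightarrow> a < 3 \<and> b < 3 \<and> a \<noteq> b" for a b
  proof -
    have "edges (cycle_graph 3) = {{0,1},{1,2},{2,0}}"
      by (auto simp: cycle_graph_def less_3_iff)
    then show ?thesis
      by (simp add: doubleton_eq_iff) presburger
  qed
  have "{i, j} \<in> edges (path_graph m) \<longleftrightarrow> i < m \<and> j < m \<and> (j = Suc i \<or> i = Suc j)" for i j
    by (auto simp: path_graph_def doubleton_eq_iff)
  then have edges: "edges (prism m) = {{(i, a), (j, b)} | i a j b. i < m \<and> j < m \<and> a < 3 \<and> b < 3 \<and>
      (i = j \<and> a \<noteq> b \<or> (j = Suc i \<or> i = Suc j) \<and> a = b)}"
    unfolding cartesian_product_def using cyc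
    by (simp add: path_graph_def cycle_graph_def) (intro Collect_cong ex_cong1; blast)
  have side: "{(i, a), (i, b)} = side i (3 - a - b)" if "a < 3" "b < 3" "a \<noteq> b" for i a b
    using that unfolding less_3_iff by (auto simp: side_def lessThan_3)
  show "edges (prism m) \<subseteq> ?sides \<union> ?rungs"
  proof
    fix e assume "e \<in> edges (prism m)"
    then obtain i a j b where e: "e = {(i, a), (j, b)}" "i < m" "j < m" "a < 3" "b < 3"
      and "i = j \<and> a \<noteq> b \<or> (j = Suc i \<or> i = Suc j) \<and> a = b"
      unfolding edges by blast
    then consider "i = j" "a \<noteq> b" | "j = Suc i" "a = b" | "i = Suc j" "a = b"
      by blast
    then show "e \<in> ?sides \<union> ?rungs"
    proof cases
      case 1
      then have "e = side i (3 - a - b)" "3 - a - b < 3"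
        using e side by (auto simp: less_3_iff)
      then show ?thesis using e by blast
    next
      case 2
      then have "e = rung i a" using e by (auto simp: rung_def)
      then show ?thesis using e 2 by blast
    next
      case 3
      then have "e = rung j a" using e by (auto simp: rung_def)
      then show ?thesis using e 3 by blast
    qed
  qed
  have in_edges: "{(i, a), (j, b)} \<in> edges (prism m)"
    if "i < m" "j < m" "a < 3" "b < 3" "i = j \<and> a \<noteq> b \<or> (j = Suc i \<or> i = Suc j) \<and> a = b"
    for i j a b
    unfolding edges mem_Collect_eq by (intro exI conjI, rule refl) (use that in auto)
  show "?sides \<union> ?rungs \<subseteq> edges (prism m)"
  proof
    fix e assume "e \<in> ?sides \<union> ?rungs"
    then consider i a where "e = side i a" "i < m" "a < 3" | i a where "e = rung i a" "Suc i < m" "a < 3"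
      by blast
    then show "e \<in> edges (prism m)"
    proof cases
      case 1
      obtain b c where "b < 3" "c < 3" "b \<noteq> c" "3 - b - c = a"
        using \<open>a < 3\<close> that[of 1 2] that[of 0 2] that[of 0 1] by (auto simp: less_3_iff)
      then show ?thesis using 1 side[of b c i] in_edges[of i i b c] by simp
    next
      case 2
      then have "e = {(i, a), (Suc i, a)}" by (auto simp: rung_def)
      then show ?thesis using 2 in_edges[of i "Suc i" a a] by simp
    qed
  qed
qed

lemma side_in_edges: "i < m \<Longrightarrow> a < 3 \<Longrightarrow> side i a \<in> edges (prism m)"
  unfolding edges_prism by blast

lemma rung_in_edges: "Suc i < m \<Longrightarrow> a < 3 \<Longrightarrow> rung i a \<in> edges (prism m)"
  unfolding edges_prism by blast

lemma side_eq_iff: "a < 3 \<Longrightarrow> b < 3 \<Longrightarrow> side i a = side j b \<longleftrightarrow> i = j \<and> a = b"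
  unfolding less_3_iff by (elim disjE) (simp_all add: side_def lessThan_3 times_eq_iff insert_Diff_if doubleton_eq_iff)

lemma rung_eq_iff: "rung i a = rung j b \<longleftrightarrow> i = j \<and> a = b"
  by (auto simp: rung_def times_eq_iff doubleton_eq_iff)

lemma side_neq_rung: "side i a \<noteq> rung j b"
proof
  assume "side i a = rung j b"
  then have "(j, b) \<in> side i a" "(Suc j, b) \<in> side i a"
    by (simp_all add: rung_def)
  then show False
    by (simp add: side_def)
qed

lemmas prism_edge_eqs = side_eq_iff rung_eq_iff side_neq_rung side_neq_rung[symmetric]

lemma side_Int_side: "a < 3 \<Longrightarrow> b < 3 \<Longrightarrow> side i a \<inter> side j b = {} \<longleftrightarrow> i \<noteq> j"
  unfolding less_3_iff by (elim disjE) (auto simp: side_def lessThan_3 Times_Int_Times insert_Diff_if)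

lemma side_Int_rung:
  "b < 3 \<Longrightarrow> side i a \<inter> rung j b = {} \<longleftrightarrow> a = b \<or> i \<noteq> j \<and> i \<noteq> Suc j"
  "b < 3 \<Longrightarrow> rung j b \<inter> side i a = {} \<longleftrightarrow> a = b \<or> i \<noteq> j \<and> i \<noteq> Suc j"
  by (auto simp: side_def rung_def)

lemma rung_Int_rung: "rung i a \<inter> rung j b = {} \<longleftrightarrow> a \<noteq> b \<or> i \<noteq> j \<and> i \<noteq> Suc j \<and> j \<noteq> Suc i"
  by (auto simp: rung_def)

lemmas prism_edge_Ints = side_Int_side side_Int_rung rung_Int_rung

lemma card_sides: "card {side i a | i a. i < n \<and> a < 3} = 3 * n"
proof -
  have "{side i a | i a. i < n \<and> a < 3} = case_prod side ` ({..<n} \<times> {..<3})"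
    by auto
  moreover have "inj_on (case_prod side) ({..<n} \<times> {..<3})"
    by (auto simp: inj_on_def side_eq_iff)
  ultimately show ?thesis by (simp add: card_image)
qed

lemma card_rungs: "card {rung i a | i a. Suc i < n \<and> a < 3} = 3 * (n - 1)"
proof -
  have "{rung i a | i a. Suc i < n \<and> a < 3} = case_prod rung ` ({..<n - 1} \<times> {..<3})"
    by (auto simp: less_diff_conv) blast
  moreover have "inj_on (case_prod rung) ({..<n - 1} \<times> {..<3})"
    by (auto simp: inj_on_def rung_eq_iff)
  ultimately show ?thesis by (simp add: card_image)
qed

lemma card_edges_prism: "card (edges (prism m)) = 3 * m + 3 * (m - 1)"
proof -
  have "finite (edges (prism m))"
    by (rule finite_edges[OF finite_simple_prism])
  then show ?thesis
    unfolding edges_prism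
    by (subst card_Un_disjoint) (auto simp: card_sides card_rungs prism_edge_eqs)
qed

section \<open>Nine perfect matchings covering each edge twice\<close>

text \<open>Both families below use the rungs with index \<open>a\<close> that leave the even columns. In the first one,
  every column is completed by its side opposite to \<open>a\<close>.\<close>

definition side_matching :: "nat \<Rightarrow> nat \<Rightarrow> (nat \<times> nat) set set" where
  "side_matching m a = {side i a | i. i < m} \<union> {rung i a | i. even i \<and> Suc i < m}"

text \<open>Here the inner columns are completed by rungs instead: the two rungs other than \<open>a\<close> that leave an
  odd column. Only the first and the last column still need a side.\<close>

definition rung_matching :: "nat \<Rightarrow> nat \<Rightarrow> (nat \<times> nat) set set" where
  "rung_matching m a = {side i a | i. i < m \<and> (i = 0 \<or> Suc i = m)} \<union>
     {rung i b | i b. Suc i < m \<and> b < 3 \<and> (even i \<longleftrightarrow> b = a)}"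

lemma even_or_pred_even:
  fixes i m :: nat
  assumes "even m" "i < m"
  obtains "even i" "Suc i < m" | j where "i = Suc j" "even j"
proof (cases "even i")
  case True
  then have "Suc i \<noteq> m" using \<open>even m\<close> by auto
  then show ?thesis using True \<open>i < m\<close> that(1) by simp
next
  case False
  then show ?thesis using that(2) by (cases i) auto
qed

lemma perfect_side_matching:
  assumes "even m" and a: "a < 3"
  shows "perfect_matching (prism m) (side_matching m a)"
proof (rule perfect_matchingI[OF finite_simple_prism])
  show "e \<inter> f = {}" if ef: "e \<in> side_matching m a" "f \<in> side_matching m a" and "e \<noteq> f" for e f
  proof -
    consider i j where "e = side i a" "f = side j a"
      | i j where "e = side i a" "f = rung j a" | i j where "f = side i a" "e = rung j a"
      | i j where "e = rung i a" "f = rung j a" "even i" "even j"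
      using ef unfolding side_matching_def by blast
    then show ?thesis
      using \<open>e \<noteq> f\<close> a by cases (auto simp: prism_edge_Ints)
  qed
  show "side_matching m a \<subseteq> edges (prism m)"
    using a unfolding side_matching_def edges_prism by blast
  have "(i, b) \<in> \<Union> (side_matching m a)" if "i < m" "b < 3" for i b
  proof (cases "b = a")
    case False
    then have "(i, b) \<in> side i a" using that by (auto simp: side_def)
    then show ?thesis using that by (auto simp: side_matching_def)
  next
    case True
    from \<open>even m\<close> \<open>i < m\<close> show ?thesis
    proof (cases rule: even_or_pred_even)
      case 1
      then have "rung i a \<in> side_matching m a" by (auto simp: side_matching_def)
      moreover have "(i, b) \<in> rung i a" using True by (simp add: rung_def)
      ultimately show ?thesis by blast
    next
      case (2 j)
      then have "rung j a \<in> side_matching m a" using that by (auto simp: side_matching_def)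
      moreover have "(i, b) \<in> rung j a" using True 2 by (simp add: rung_def)
      ultimately show ?thesis by blast
    qed
  qed
  then show "v \<in> \<Union> (side_matching m a)" if "v \<in> verts (prism m)" for v
    using that by (cases v) (auto simp: verts_prism)
qed

lemma perfect_rung_matching:
  assumes "even m" and a: "a < 3"
  shows "perfect_matching (prism m) (rung_matching m a)"
proof (rule perfect_matchingI[OF finite_simple_prism])
  show "rung_matching m a \<subseteq> edges (prism m)"
    using a unfolding rung_matching_def edges_prism by blast
  have apart: "side i a \<inter> rung j b = {}"
    if "i = 0 \<or> Suc i = m" "Suc j < m" "b < 3" "even j \<longleftrightarrow> b = a" for i j b
    using that a \<open>even m\<close> by (auto simp: side_Int_rung)
  show "e \<inter> f = {}" if ef: "e \<in> rung_matching m a" "f \<in> rung_matching m a" and "e \<noteq> f" for e f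
  proof -
    consider i j where "e = side i a" "f = side j a"
      | i j b where "e = side i a" "f = rung j b" "i = 0 \<or> Suc i = m" "Suc j < m" "b < 3" "even j \<longleftrightarrow> b = a"
      | i j b where "f = side i a" "e = rung j b" "i = 0 \<or> Suc i = m" "Suc j < m" "b < 3" "even j \<longleftrightarrow> b = a"
      | i j b c where "e = rung i b" "f = rung j c" "even i \<longleftrightarrow> b = a" "even j \<longleftrightarrow> c = a"
      using ef unfolding rung_matching_def by blast
    then show ?thesis
    proof cases
      case 1
      then show ?thesis using \<open>e \<noteq> f\<close> a by (auto simp: side_Int_side)
    next
      case 2
      then show ?thesis using apart by simp
    next
      case 3
      then show ?thesis using apart by (simp add: Int_commute)
    next
      case 4
      then show ?thesis using \<open>e \<noteq> f\<close> by (auto simp: rung_Int_rung)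
    qed
  qed
  have "(i, b) \<in> \<Union> (rung_matching m a)" if "i < m" "b < 3" for i b
  proof -
    have rung: "rung j b \<in> rung_matching m a" if "Suc j < m" "even j \<longleftrightarrow> b = a" for j
      using that \<open>b < 3\<close> by (auto simp: rung_matching_def)
    have in_rung: "(i, b) \<in> rung i b" and in_rung_Suc: "i = Suc j \<Longrightarrow> (i, b) \<in> rung j b" for j
      by (auto simp: rung_def)
    have side: "side i a \<in> rung_matching m a" if "i = 0 \<or> Suc i = m"
      using that \<open>i < m\<close> by (auto simp: rung_matching_def)
    have in_side: "(i, b) \<in> side i a" if "b \<noteq> a"
      using that \<open>b < 3\<close> by (auto simp: side_def)
    from \<open>even m\<close> \<open>i < m\<close> show ?thesis
    proof (cases rule: even_or_pred_even)
      case 1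
      show ?thesis
      proof (cases "b = a")
        case True
        then show ?thesis using rung[of i] in_rung 1 by blast
      next
        case False
        show ?thesis
        proof (cases i)
          case 0
          then show ?thesis using side in_side False by blast
        next
          case (Suc j)
          then show ?thesis using rung[of j] in_rung_Suc[of j] 1 False \<open>i < m\<close> by auto
        qed
      qed
    next
      case (2 j)
      show ?thesis
      proof (cases "b = a")
        case True
        then show ?thesis using rung[of j] in_rung_Suc[of j] 2 \<open>i < m\<close> by blast
      next
        case False
        show ?thesis
        proof (cases "Suc i = m")
          case True
          then show ?thesis using side in_side False by blast
        next
          case Suc: False
          then have "Suc i < m" using \<open>i < m\<close> by simp
          then show ?thesis using rung[of i] in_rung 2 False by auto
        qed
      qed
    qed
  qed
  then show "v \<in> \<Union> (rung_matching m a)" if "v \<in> verts (prism m)" for v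
    using that by (cases v) (auto simp: verts_prism)
qed

lemma matching_number_prism:
  assumes "even m"
  shows "2 * \<nu> (prism m) = 3 * m"
    and "maximum_matching (prism m) M \<longleftrightarrow> perfect_matching (prism m) M"
  using maximum_matching_iff_perfect[OF finite_simple_prism perfect_side_matching[OF assms, of 0]]
  by (simp_all add: verts_prism)

text \<open>The three side matchings are counted twice and the three rung matchings once, nine in total.
  A side and a rung leaving an even column lie in a side matching, which counts twice. A rung with
  index \<open>a\<close> leaving an odd column lies in the two rung matchings with index different from \<open>a\<close>.\<close>

lemma card_le_if_few_in_perfect_matchings:
  assumes "even m" and S: "S \<subseteq> edges (prism m)"
    and few: "\<And>M. perfect_matching (prism m) M \<Longrightarrow> card (S \<inter> M) \<le> k"
  shows "2 * card S \<le> 9 * k"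
proof -
  \<comment> \<open>The second component of an index is its multiplicity and also selects the family.\<close>
  let ?I = "{..<3::nat} \<times> {1, 2::nat}"
  let ?M = "\<lambda>i. if snd i = 2 then side_matching m (fst i) else rung_matching m (fst i)"
  have cover: "2 \<le> sum snd {i \<in> ?I. e \<in> ?M i}" if "e \<in> S" for e
  proof -
    have *: "sum snd J \<le> sum snd {i \<in> ?I. e \<in> ?M i}" if "J \<subseteq> {i \<in> ?I. e \<in> ?M i}" for J
      using that by (intro sum_mono2) auto
    obtain i a where "a < 3" and e: "e = side i a \<and> i < m \<or> e = rung i a \<and> Suc i < m"
      using \<open>e \<in> S\<close> S unfolding edges_prism by blast
    show ?thesis
    proof (cases "e \<in> side_matching m a")
      case True
      then show ?thesis using *[of "{(a, 2)}"] \<open>a < 3\<close> by simp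
    next
      case False
      then have "e = rung i a" "Suc i < m" "odd i"
        using e by (auto simp: side_matching_def)
      then have "e \<in> rung_matching m b" if "b \<noteq> a" for b
        using that \<open>a < 3\<close> by (auto simp: rung_matching_def)
      then have "sum snd (({..<3} - {a}) \<times> {1::nat}) \<le> sum snd {i \<in> ?I. e \<in> ?M i}"
        by (intro *) auto
      moreover have "sum snd (({..<3} - {a}) \<times> {1::nat}) = 2"
        using \<open>a < 3\<close> by (simp add: sum.cartesian_product[symmetric] snd_def)
      ultimately show ?thesis by simp
    qed
  qed
  have few': "card (S \<inter> ?M i) \<le> k" if "i \<in> ?I" for i
    using that few perfect_side_matching[OF \<open>even m\<close>] perfect_rung_matching[OF \<open>even m\<close>] by auto
  have "finite S"
    using S finite_edges[OF finite_simple_prism] finite_subset by blast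
  then have "2 * card S \<le> k * sum snd ?I"
    using weighted_double_count[of S ?I 2 snd ?M k, OF _ _ cover few'] by simp
  also have "sum snd ?I = 9"
    by (simp add: sum.cartesian_product[symmetric] snd_def)
  finally show ?thesis by simp
qed

section \<open>Large edge sets that perfect matchings rarely meet\<close>

definition block :: "nat \<Rightarrow> (nat \<times> nat) set set" where
  "block i = side i ` {..<3} \<union> side (Suc i) ` {..<3} \<union> rung i ` {..<3}"

lemma finite_block: "finite (block i)"
  by (simp add: block_def)

lemma card_block: "card (block i) = 9"
proof -
  have sides: "card (side j ` {..<3}) = 3" for j
    by (subst card_image) (auto simp: inj_on_def side_eq_iff)
  have rungs: "card (rung i ` {..<3}) = 3"
    by (subst card_image) (auto simp: inj_on_def rung_eq_iff)
  have disj: "side i ` {..<3} \<inter> side (Suc i) ` {..<3} = {}"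
    "(side i ` {..<3} \<union> side (Suc i) ` {..<3}) \<inter> rung i ` {..<3} = {}"
    by (auto simp: side_eq_iff side_neq_rung side_neq_rung[symmetric])
  show ?thesis
    unfolding block_def by (simp add: card_Un_disjoint disj sides rungs)
qed

text \<open>The columns up to \<open>i\<close> have \<open>3 (i + 1)\<close> vertices, an even number. The matching covers each of them
  once, and only the rungs between columns \<open>i\<close> and \<open>i + 1\<close> cover exactly one of them: every other
  edge covers none or two.\<close>

lemma even_rungs_after_even_prefix:
  assumes M: "perfect_matching (prism m) M" and "Suc i < m" and "odd i"
  shows "even (card (rung i ` {..<3} \<inter> M))"
proof -
  let ?U = "{..i} \<times> {..<3::nat}"
  note fin = finite_matching[OF finite_simple_prism]
  have M': "matching (prism m) M" "\<Union>M = {..<m} \<times> {..<3}"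
    using M by (auto simp: perfect_matching_def verts_prism)
  have odd_iff: "odd (card (e \<inter> ?U)) \<longleftrightarrow> e \<in> rung i ` {..<3}" if "e \<in> M" for e
  proof -
    have "e \<in> edges (prism m)"
      using that M' by (auto simp: matching_def)
    then consider j a where "e = side j a" "a < 3" | j a where "e = rung j a" "a < 3"
      unfolding edges_prism by blast
    then show ?thesis
    proof cases
      case 1
      then have "e \<inter> ?U = (if j \<le> i then {j} \<times> ({..<3} - {a}) else {})"
        by (auto simp: side_def)
      then show ?thesis using 1 by (auto simp: side_neq_rung card_cartesian_product)
    next
      case 2
      then have "e \<inter> ?U = (if j < i then {j, Suc j} \<times> {a} else if j = i then {j} \<times> {a} else {})"
        by (auto simp: rung_def)
      then show ?thesis using 2 by (auto simp: rung_eq_iff card_cartesian_product)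
    qed
  qed
  have "(\<Sum>e\<in>M. card (e \<inter> ?U)) = card (\<Union>M \<inter> ?U)"
    using sum_card_Int_matching[OF finite_simple_prism] M' by blast
  also have "\<Union>M \<inter> ?U = ?U"
    using M' \<open>Suc i < m\<close> by auto
  also have "card ?U = 3 * Suc i"
    by (simp add: card_cartesian_product)
  finally have "even (\<Sum>e\<in>M. card (e \<inter> ?U))"
    using \<open>odd i\<close> by simp
  then have "even (card {e \<in> M. odd (card (e \<inter> ?U))})"
    by (simp only: even_sum_iff[OF fin[OF M'(1)]] not_False_eq_True)
  also have "{e \<in> M. odd (card (e \<inter> ?U))} = rung i ` {..<3} \<inter> M"
    using odd_iff by blast
  finally show ?thesis .
qed

lemma card_block_Int_le_2:
  assumes M: "perfect_matching (prism m) M" and "Suc i < m" and "odd i"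
  shows "card (block i \<inter> M) \<le> 2"
proof -
  let ?R = "rung i ` {..<3} \<inter> M"
  have match: "matching (prism m) M"
    using M by (simp add: perfect_matching_def)
  have side: "card (side j ` {..<3} \<inter> M) \<le> 1" for j
    using match by (intro card_Int_matching_le_1) (auto simp: side_Int_side)
  have even: "even (card ?R)"
    using even_rungs_after_even_prefix[OF assms] .
  have block: "block i \<inter> M = (side i ` {..<3} \<inter> M) \<union> (side (Suc i) ` {..<3} \<inter> M) \<union> ?R"
    by (auto simp: block_def)
  show ?thesis
  proof (cases "?R = {}")
    case True
    then have "card (block i \<inter> M) \<le> card (side i ` {..<3} \<inter> M) + card (side (Suc i) ` {..<3} \<inter> M)"
      unfolding block by (simp add: card_Un_le)
    then show ?thesis using side[of i] side[of "Suc i"] by simp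
  next
    case False
    \<comment> \<open>A side in either column would leave room for only one rung, an odd number.\<close>
    have no_side: "side j ` {..<3} \<inter> M = {}" if "j = i \<or> j = Suc i" for j
    proof (rule ccontr)
      assume "side j ` {..<3} \<inter> M \<noteq> {}"
      then obtain a where a: "side j a \<in> M" "a < 3" by auto
      have "b = a" if "rung i b \<in> M" "b < 3" for b
      proof -
        have "side j a \<inter> rung i b = {}"
          using match a that side_neq_rung[of j a i b] unfolding matching_def by blast
        then show ?thesis using that \<open>j = i \<or> j = Suc i\<close> by (auto simp: side_Int_rung)
      qed
      then have "?R \<subseteq> {rung i a}" by auto
      then have "card ?R = 1" using False by (metis subset_singletonD is_singletonI is_singleton_altdef)
      then show False using even by simp
    qed
    have "card ?R \<le> card (rung i ` {..<3})"
      by (intro card_mono) auto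
    also have "\<dots> \<le> 3"
      using card_image_le[of "{..<3::nat}" "rung i"] by simp
    finally have "card ?R \<le> 2"
      using even by (cases "card ?R = 3") auto
    then show ?thesis using no_side[of i] no_side[of "Suc i"] by (simp add: block)
  qed
qed

text \<open>The four edges at the vertex \<open>(i + 1, 0)\<close>.\<close>

definition star :: "nat \<Rightarrow> (nat \<times> nat) set set" where
  "star i = {side (Suc i) 1, side (Suc i) 2, rung i 0, rung (Suc i) 0}"

lemma card_star: "card (star i) = 4"
  by (simp add: star_def prism_edge_eqs)

lemma card_star_Int_le_1:
  assumes "matching (prism m) M"
  shows "card (star i \<inter> M) \<le> 1"
proof (rule card_Int_matching_le_1[OF _ assms])
  have "(Suc i, 0) \<in> e" if "e \<in> star i" for e
    using that by (auto simp: star_def) (simp_all add: side_def rung_def)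
  then show "e \<inter> f \<noteq> {}" if "e \<in> star i" "f \<in> star i" for e f
    using that by blast
qed (simp add: star_def)

text \<open>The blocks start at the columns \<open>1, 3, 5, \<dots>\<close> and so use pairwise different columns. For odd \<open>k\<close> the
  star is placed at a vertex of column \<open>m - 2\<close>, the last column that has rungs on both sides.\<close>

lemma ex_few_in_perfect_matchings:
  assumes "even m" and "k + 3 \<le> m"
  shows "\<exists>S \<subseteq> edges (prism m). card S = 9 * k div 2 \<and>
           (\<forall>M. perfect_matching (prism m) M \<longrightarrow> card (S \<inter> M) \<le> k)"
proof -
  define j where "j = k div 2"
  define B where "B = (\<Union>i<j. block (2 * i + 1))"
  define S where "S = (if even k then B else B \<union> star (m - 3))"
  have "2 * j + 3 \<le> m"
    using assms unfolding j_def by linarith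
  \<comment> \<open>Parity of \<open>m\<close> gains one: the last block ends in column \<open>2 j \<le> m - 4\<close>, and the rungs of the star do
      not belong to any block.\<close>
  then have m: "2 * j + 4 \<le> m"
    using \<open>even m\<close> by (cases "m = 2 * j + 3") auto
  have "block i \<inter> block l = {}" if "i \<noteq> l" "odd i" "odd l" for i l
    using that by (auto simp: block_def side_eq_iff rung_eq_iff side_neq_rung side_neq_rung[symmetric])
  then have cardB: "card B = 9 * j"
    unfolding B_def by (subst card_UN_disjoint) (auto simp: finite_block card_block)
  have "B \<inter> star (m - 3) = {}"
    using m by (auto simp: B_def block_def star_def prism_edge_eqs)
  then have "card (B \<union> star (m - 3)) = 9 * j + 4"
    using cardB card_star by (subst card_Un_disjoint) (simp_all add: B_def finite_block star_def)
  then have "card S = 9 * k div 2"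
    unfolding S_def j_def using cardB[unfolded j_def] by (auto elim!: evenE oddE)
  moreover have "S \<subseteq> edges (prism m)"
  proof -
    have "block (2 * i + 1) \<subseteq> edges (prism m)" if "i < j" for i
      using that m by (simp add: block_def image_subset_iff side_in_edges rung_in_edges)
    moreover have "star (m - 3) \<subseteq> edges (prism m)"
      using m by (simp add: star_def side_in_edges rung_in_edges)
    ultimately show ?thesis by (auto simp: S_def B_def)
  qed
  moreover have "card (S \<inter> M) \<le> k" if M: "perfect_matching (prism m) M" for M
  proof -
    have "B \<inter> M = (\<Union>i<j. block (2 * i + 1) \<inter> M)"
      by (auto simp: B_def)
    then have "card (B \<inter> M) \<le> (\<Sum>i<j. card (block (2 * i + 1) \<inter> M))"
      by (simp only: card_UN_le[OF finite_lessThan])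
    also have "\<dots> \<le> (\<Sum>i<j. 2)"
      using m by (intro sum_mono card_block_Int_le_2[OF M]) auto
    finally have B: "card (B \<inter> M) \<le> 2 * j" by simp
    have "card ((B \<union> star (m - 3)) \<inter> M) \<le> card (B \<inter> M) + card (star (m - 3) \<inter> M)"
      by (simp add: Int_Un_distrib2 card_Un_le)
    also have "\<dots> \<le> 2 * j + 1"
      using B card_star_Int_le_1[of m M "m - 3"] M by (simp add: perfect_matching_def)
    finally show ?thesis
      using B unfolding S_def j_def by (auto elim!: evenE oddE)
  qed
  ultimately show ?thesis by blast
qed

section \<open>The transversal number\<close>

theorem lemma3p14:
  fixes m d :: nat
  assumes "m \<ge> 4" and "even m"
    and "real m / 2 + 3 \<le> real d" and "real d \<le> 3 * real m / 2"
  shows "real (\<tau> d (path_graph m \<box> cycle_graph 3)) =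
           4 * real d - real m / 2 - 2 + real_of_int \<lfloor>(2 * real d - real m - 2) / 4\<rfloor>"
proof -
  obtain p where p: "m = 2 * p"
    using \<open>even m\<close> by (rule evenE)
  have d: "p + 3 \<le> d" "d \<le> 3 * p"
    using assms(3,4) by (auto simp: p)
  define k where "k = 3 * p - d"
  have k: "k + 3 \<le> m" and dk: "real d = 3 * real p - real k"
    using d by (auto simp: k_def p)
  have nu: "\<nu> (prism m) = 3 * p"
    using matching_number_prism(1)[OF \<open>even m\<close>] by (simp add: p)
  obtain S where S: "S \<subseteq> edges (prism m)" "card S = 9 * k div 2"
    "\<And>M. perfect_matching (prism m) M \<Longrightarrow> card (S \<inter> M) \<le> k"
    using ex_few_in_perfect_matchings[OF \<open>even m\<close> k] by blast
  have "\<tau> d (prism m) = card (edges (prism m)) - card S"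
  proof (rule transversal_number_complement)
    show "card S' \<le> card S" if "S' \<subseteq> edges (prism m)"
      "\<And>M. maximum_matching (prism m) M \<Longrightarrow> card (S' \<inter> M) \<le> \<nu> (prism m) - d" for S'
      using card_le_if_few_in_perfect_matchings[of m S' k] that \<open>even m\<close> S(2)
      by (auto simp: nu k_def matching_number_prism(2))
  qed (use S d \<open>even m\<close> nu in \<open>auto simp: finite_simple_prism matching_number_prism(2) k_def\<close>)
  then have tau: "\<tau> d (prism m) = 12 * p - 3 - 9 * k div 2"
    using S(2) d by (simp add: card_edges_prism p)
  define j where "j = k div 2"
  have "\<lfloor>(2 * real d - real m - 2) / 4\<rfloor> = int p - 1 - int j"
  proof (rule floor_unique)
    have "2 * j \<le> k" "k \<le> 2 * j + 1"
      unfolding j_def by linarith+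
    then show "real_of_int (int p - 1 - int j) \<le> (2 * real d - real m - 2) / 4"
      "(2 * real d - real m - 2) / 4 < real_of_int (int p - 1 - int j) + 1"
      by (simp_all add: dk p field_simps)
  qed
  moreover have "real (\<tau> d (prism m)) = 12 * real p - 3 - (4 * real k + real j)"
  proof -
    have "9 * k div 2 = 4 * k + j"
      unfolding j_def by presburger
    moreover have "4 * k + j + 3 \<le> 12 * p"
      using k p unfolding j_def by linarith
    ultimately show ?thesis
      by (simp add: tau of_nat_diff)
  qed
  ultimately show ?thesis
    by (simp add: dk p)
qed

end
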